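(* Let $A_0,A_1,A_2$ be three non-collinear points in $\mathbb{R}^n$, let $G=\frac{1}{3}(A_0+A_1+A_2)$, let $P\in\mathbb{R}^n$ be a point equidistant from $A_0,A_1,A_2$, and let $H_P=A_0+A_1+A_2-2P$ be the orthocenter of $\triangle A_0A_1A_2$ associated with $P$. For $\{i,j,k\}=\{0,1,2\}$ let $M_i=\frac{1}{2}(A_j+A_k)$, let $B_i=A_j+A_k-P$ be the reflection of $P$ with respect to $M_i$, let $N_i=\frac{1}{2}(B_j+B_k)$, and let $G_i=\frac{1}{3}(H_P+A_j+A_k)$ (so $G_0,G_1,G_2$ are the centroids of $\triangle H_PA_1A_2$, $\triangle A_0H_PA_2$, $\triangle A_0A_1H_P$, respectively). Then each of the following is an orthocentric system: $$\{A_0,A_1,A_2,H_P\},\quad \{B_0,B_1,B_2,P\},\quad \{M_0,M_1,M_2,P\},\quad \{N_0,N_1,N_2,H_P\},\quad \{G_0,G_1,G_2,G\}.$$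
   Context: $\mathbb{R}^n$ carries the Euclidean norm. For non-collinear points $X_0,X_1,X_2\in\mathbb{R}^n$, let $\mathcal{C}(\triangle X_0X_1X_2)$ be the set of points of $\mathbb{R}^n$ equidistant from $X_0,X_1,X_2$. Four points $\{X_0,X_1,X_2,X_3\}$ of $\mathbb{R}^n$ (listed in this order, not required to be distinct) form an orthocentric system if $X_0,X_1,X_2$ are non-collinear and there is a point $R\in\mathcal{C}(\triangle X_0X_1X_2)$ such that $X_3=X_0+X_1+X_2-2R$. *)

theory Defs
  imports "HOL-Analysis.Analysis"
begin

definition circumcenters :: "real^'n \<Rightarrow> real^'n \<Rightarrow> real^'n \<Rightarrow> (real^'n) set" where
  "circumcenters X0 X1 X2 = {R. dist R X0 = dist R X1 \<and> dist R X1 = dist R X2}"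

text \<open>The four points are taken in order, the first three being the vertices of the triangle;
  they are not required to be distinct.\<close>

definition orthocentric_system ::
    "real^'n \<Rightarrow> real^'n \<Rightarrow> real^'n \<Rightarrow> real^'n \<Rightarrow> bool" where
  "orthocentric_system X0 X1 X2 X3 \<longleftrightarrow>
     \<not> collinear {X0, X1, X2} \<and>
     (\<exists>R \<in> circumcenters X0 X1 X2. X3 = X0 + X1 + X2 - 2 *\<^sub>R R)"

end

theory Submission
  imports Defs
begin

text \<open>The relation of being an orthocentric system is invariant under the maps
  \<open>X \<mapsto> a X + T\<close> with \<open>a \<noteq> 0\<close>, because the coefficients in \<open>X0 + X1 + X2 - 2 R\<close> sum
  to 1. The other four systems are the images of the first one under such maps, with
  ratios -1, -1/2, 1/2 and -1/3.\<close>

text \<open>Collinearity means affine dimension at most 1, and neither a translation nor an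
  injective linear map changes the affine dimension.\<close>

lemma collinear_homothety_iff:
  fixes X Y Z T :: "'a::euclidean_space"
  assumes "a \<noteq> 0"
  shows "collinear {a *\<^sub>R X + T, a *\<^sub>R Y + T, a *\<^sub>R Z + T} \<longleftrightarrow> collinear {X, Y, Z}"
proof -
  have "{a *\<^sub>R X + T, a *\<^sub>R Y + T, a *\<^sub>R Z + T} = (+) T ` (\<lambda>X. a *\<^sub>R X) ` {X, Y, Z}"
    by (auto simp: add.commute)
  moreover have "linear (\<lambda>X::'a. a *\<^sub>R X)" "inj (\<lambda>X::'a. a *\<^sub>R X)"
    using assms by (auto simp: inj_on_def)
  ultimately show ?thesis
    by (simp only: collinear_aff_dim aff_dim_translation_eq aff_dim_injective_linear_image)
qed

lemma orthocentric_system_homothety: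
  assumes "orthocentric_system X0 X1 X2 X3" "a \<noteq> 0"
  shows "orthocentric_system (a *\<^sub>R X0 + T) (a *\<^sub>R X1 + T) (a *\<^sub>R X2 + T) (a *\<^sub>R X3 + T)"
proof -
  obtain R where R: "dist R X0 = dist R X1" "dist R X1 = dist R X2"
      "X3 = X0 + X1 + X2 - 2 *\<^sub>R R"
    using assms(1) by (auto simp: orthocentric_system_def circumcenters_def)
  \<comment> \<open>The new witness is the image of \<open>R\<close>: the map multiplies every
    distance by |a|, so equidistance survives.\<close>
  have "a *\<^sub>R R + T \<in> circumcenters (a *\<^sub>R X0 + T) (a *\<^sub>R X1 + T) (a *\<^sub>R X2 + T)"
    using R(1,2) by (simp add: circumcenters_def dist_norm flip: scaleR_diff_right)
  moreover have "a *\<^sub>R X3 + T =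
      (a *\<^sub>R X0 + T) + (a *\<^sub>R X1 + T) + (a *\<^sub>R X2 + T) - 2 *\<^sub>R (a *\<^sub>R R + T)"
    by (simp add: R(3) vec_eq_iff algebra_simps)
  ultimately show ?thesis
    using assms by (auto simp: orthocentric_system_def collinear_homothety_iff)
qed

theorem theorem3:
  fixes A M B N C :: "nat \<Rightarrow> real^'n" and G P H :: "real^'n"
  assumes "\<not> collinear {A 0, A 1, A 2}"
    and "G = (1/3) *\<^sub>R (A 0 + A 1 + A 2)"
    and "P \<in> circumcenters (A 0) (A 1) (A 2)"
    and "H = A 0 + A 1 + A 2 - 2 *\<^sub>R P"
    and "\<And>i j k. {i, j, k} = {0, 1, 2} \<Longrightarrow> M i = (1/2) *\<^sub>R (A j + A k)"
    and "\<And>i j k. {i, j, k} = {0, 1, 2} \<Longrightarrow> B i = A j + A k - P"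
    and "\<And>i j k. {i, j, k} = {0, 1, 2} \<Longrightarrow> N i = (1/2) *\<^sub>R (B j + B k)"
    and "\<And>i j k. {i, j, k} = {0, 1, 2} \<Longrightarrow> C i = (1/3) *\<^sub>R (H + A j + A k)"
  shows "orthocentric_system (A 0) (A 1) (A 2) H
       \<and> orthocentric_system (B 0) (B 1) (B 2) P
       \<and> orthocentric_system (M 0) (M 1) (M 2) P
       \<and> orthocentric_system (N 0) (N 1) (N 2) H
       \<and> orthocentric_system (C 0) (C 1) (C 2) G"
proof -
  \<comment> \<open>One choice of (i, j, k) for each i, at which the indexed hypotheses are
    instantiated.\<close>
  have perm: "{0, 1, 2} = {0, 1, 2::nat}" "{1, 0, 2} = {0, 1, 2::nat}" "{2, 0, 1} = {0, 1, 2::nat}"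
    by auto
  note M = perm[THEN assms(5)] and B = perm[THEN assms(6)]
    and N = perm[THEN assms(7)] and C = perm[THEN assms(8)]
  \<comment> \<open>Keeps the index 1 from becoming \<open>Suc 0\<close>, so that the equations for
    \<open>B 1\<close>, \<open>M 1\<close> and so on still match.\<close>
  note One_nat_def [simp del]
  \<comment> \<open>Since A_j + A_k = S - A_i, each new vertex becomes an expression in A_i and
    constants, from which its map can be read off.\<close>
  define S where "S = A 0 + A 1 + A 2"
  have A_sys: "orthocentric_system (A 0) (A 1) (A 2) H"
    using assms(1,3,4) by (auto simp: orthocentric_system_def)
  note image = orthocentric_system_homothety[OF A_sys]
  \<comment> \<open>Point reflection in (S - P)/2, which is the midpoint of \<open>H\<close> and
    \<open>P\<close>.\<close>
  have "(-1) *\<^sub>R A 0 + (S - P) = B 0" "(-1) *\<^sub>R A 1 + (S - P) = B 1"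
      "(-1) *\<^sub>R A 2 + (S - P) = B 2" "(-1) *\<^sub>R H + (S - P) = P"
    by (simp_all add: B assms(4) S_def vec_eq_iff)
  then have B_sys: "orthocentric_system (B 0) (B 1) (B 2) P"
    using image[of "-1" "S - P"] by (metis zero_neq_neg_one)
  \<comment> \<open>Homothety of ratio -1/2 centred at the centroid \<open>G\<close> = S/3.\<close>
  have "(-1/2) *\<^sub>R A 0 + (1/2) *\<^sub>R S = M 0" "(-1/2) *\<^sub>R A 1 + (1/2) *\<^sub>R S = M 1"
      "(-1/2) *\<^sub>R A 2 + (1/2) *\<^sub>R S = M 2" "(-1/2) *\<^sub>R H + (1/2) *\<^sub>R S = P"
    by (simp_all add: M assms(4) S_def vec_eq_iff field_simps)
  then have M_sys: "orthocentric_system (M 0) (M 1) (M 2) P"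
    using image[of "-1/2" "(1/2) *\<^sub>R S"] by simp
  \<comment> \<open>Expanding B_j + B_k gives A_i + S - 2P = A_i + H, so N_i is the midpoint of A_i
    and \<open>H\<close>; the centre \<open>H\<close> is fixed.\<close>
  have "(1/2) *\<^sub>R A 0 + (1/2) *\<^sub>R H = N 0" "(1/2) *\<^sub>R A 1 + (1/2) *\<^sub>R H = N 1"
      "(1/2) *\<^sub>R A 2 + (1/2) *\<^sub>R H = N 2" "(1/2) *\<^sub>R H + (1/2) *\<^sub>R H = H"
    by (simp_all add: N B assms(4) vec_eq_iff field_simps)
  then have N_sys: "orthocentric_system (N 0) (N 1) (N 2) H"
    using image[of "1/2" "(1/2) *\<^sub>R H"] by simp
  \<comment> \<open>Homothety of ratio -1/3 centred at (H + S)/4, the centroid of the four points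
    A_0, A_1, A_2, H: each goes to the centroid of the other three.\<close>
  have "(-1/3) *\<^sub>R A 0 + (1/3) *\<^sub>R (H + S) = C 0" "(-1/3) *\<^sub>R A 1 + (1/3) *\<^sub>R (H + S) = C 1"
      "(-1/3) *\<^sub>R A 2 + (1/3) *\<^sub>R (H + S) = C 2" "(-1/3) *\<^sub>R H + (1/3) *\<^sub>R (H + S) = G"
    by (simp_all add: C assms(2) S_def vec_eq_iff field_simps)
  then have C_sys: "orthocentric_system (C 0) (C 1) (C 2) G"
    using image[of "-1/3" "(1/3) *\<^sub>R (H + S)"] by simp
  show ?thesis
    using A_sys B_sys M_sys N_sys C_sys by blast
qed

end
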